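(* Let $A,B$ be commutative, associative $\mathbb{C}$-algebras. If $f:A\to B$ is a Frobenius $n$-homomorphism, then the map $$\frac{\Phi_n(f)}{n!}:\mathcal{S}^nA\to B$$ is a ring homomorphism. Conversely, if $f:A\to B$ is linear, $f(1)=n$ and $\frac{\Phi_n(f)}{n!}:\mathcal{S}^nA\to B$ is a ring homomorphism, then $f$ is a Frobenius $n$-homomorphism.
   Context: Algebras are unital. $\mathcal{S}^nA$ denotes the subalgebra of symmetric tensors in $A^{\otimes n}$ (tensor product over $\mathbb{C}$). For a linear map $f:A\to B$ and $n\ge1$, define the linear map $\Phi_n(f):A^{\otimes n}\to B$ by $\Phi_n(f)(a_1,\dots,a_n)=\sum_{\sigma\in\Sigma_n}\varepsilon_\sigma f_{\gamma_1}(a_1,\dots,a_n)\cdots f_{\gamma_r}(a_1,\dots,a_n)$, where $\sigma=\gamma_1\cdots\gamma_r$ is the decomposition into disjoint cycles of total length $n$ (cycles of length 1 included), $\varepsilon_\sigma$ is the sign of $\sigma$, and $f_\gamma(a_1,\dots,a_n)=f(a_{i_1}a_{i_2}\cdots a_{i_m})$ for a cycle $\gamma=(i_1\dots i_m)$. The map $\Phi_n(f)/n!$ on $\mathcal{S}^nA$ is the restriction of $\Phi_n(f)/n!$ from $A^{\otimes n}$. A linear map $f:A\to B$ is a Frobenius $n$-homomorphism if $f(1)=n$ and $\Phi_{n+1}(f)\equiv0$. *)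

theory Defs
  imports Complex_Main "HOL-Library.Poly_Mapping" "HOL-Combinatorics.Combinatorics"
begin

section \<open>Complex vector spaces and commutative complex algebras\<close>

class complex_vector = ab_group_add +
  fixes scaleC :: "complex \<Rightarrow> 'a \<Rightarrow> 'a" (infixr \<open>*\<^sub>C\<close> 75)
  assumes scaleC_add_right: "c *\<^sub>C (x + y) = c *\<^sub>C x + c *\<^sub>C y"
    and scaleC_add_left: "(c + d) *\<^sub>C x = c *\<^sub>C x + d *\<^sub>C x"
    and scaleC_scaleC: "c *\<^sub>C d *\<^sub>C x = (c * d) *\<^sub>C x"
    and scaleC_one: "1 *\<^sub>C x = x"

text \<open>Unital, commutative and associative. The zero algebra is not excluded: the superclasses do
  not include \<^class>\<open>zero_neq_one\<close>, which \<^class>\<open>comm_ring_1\<close> would bring in.\<close>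
class complex_comm_algebra = complex_vector + comm_ring + comm_monoid_mult +
  assumes scaleC_mult_left: "(c *\<^sub>C x) * y = c *\<^sub>C (x * y)"

global_interpretation complex_vector: vector_space "scaleC :: complex \<Rightarrow> 'a \<Rightarrow> 'a::complex_vector"
  by unfold_locales (simp_all add: scaleC_add_right scaleC_add_left scaleC_scaleC scaleC_one)

abbreviation clinear :: "('a::complex_vector \<Rightarrow> 'b::complex_vector) \<Rightarrow> bool" where
  "clinear \<equiv> Vector_Spaces.linear scaleC scaleC"

lemma clinearI:
  assumes "\<And>x y. f (x + y) = f x + f y" "\<And>c x. f (c *\<^sub>C x) = c *\<^sub>C f x"
  shows "clinear f"
  by unfold_locales (simp_all add: assms)

lemma
  shows clinear_add: "clinear f \<Longrightarrow> f (x + y) = f x + f y"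
  and clinear_scale: "clinear f \<Longrightarrow> f (c *\<^sub>C x) = c *\<^sub>C f x"
  and clinear_diff: "clinear f \<Longrightarrow> f (x - y) = f x - f y"
  and clinear_zero: "clinear f \<Longrightarrow> f 0 = 0"
  and clinear_sum: "clinear f \<Longrightarrow> f (sum g I) = (\<Sum>i\<in>I. f (g i))"
  by (simp_all add: linear_iff_module_hom module_hom.add module_hom.scale module_hom.diff
        module_hom.zero module_hom.sum)

lemma scaleC_mult_right: "x * (c *\<^sub>C y) = c *\<^sub>C (x * y)" for x y :: "'a::complex_comm_algebra"
  by (metis mult.commute scaleC_mult_left)

instantiation complex :: complex_comm_algebra
begin
definition "scaleC_complex (c::complex) (x::complex) = c * x"
instance by standard (simp_all add: scaleC_complex_def algebra_simps)
end

instantiation poly_mapping :: (type, complex_vector) complex_vector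
begin
definition "scaleC_poly_mapping c x = Poly_Mapping.map (scaleC c) x"
instance
proof -
  have *: "Poly_Mapping.lookup (c *\<^sub>C x) i = c *\<^sub>C Poly_Mapping.lookup x i"
    for c and x :: "'a \<Rightarrow>\<^sub>0 'b" and i
    unfolding scaleC_poly_mapping_def by transfer (simp add: when_def)
  show "OFCLASS('a \<Rightarrow>\<^sub>0 'b, complex_vector_class)"
    by standard (rule poly_mapping_eqI,
        simp add: * lookup_add scaleC_add_right scaleC_add_left scaleC_scaleC scaleC_one)+
qed
end

lemma lookup_scaleC: "Poly_Mapping.lookup (c *\<^sub>C x) i = c *\<^sub>C Poly_Mapping.lookup x i"
  unfolding scaleC_poly_mapping_def by transfer (simp add: when_def)

text \<open>\<^typ>\<open>'i \<Rightarrow>\<^sub>0 complex\<close> is the free vector space on \<^typ>\<open>'i\<close>, with basis \<^term>\<open>\<lambda>i. Poly_Mapping.single i 1\<close>.\<close>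

abbreviation basis :: "'i \<Rightarrow> 'i \<Rightarrow>\<^sub>0 complex" where
  "basis i \<equiv> Poly_Mapping.single i 1"

definition lin_extend :: "('i \<Rightarrow> 'b::complex_vector) \<Rightarrow> ('i \<Rightarrow>\<^sub>0 complex) \<Rightarrow> 'b" where
  "lin_extend g x = (\<Sum>i\<in>Poly_Mapping.keys x. Poly_Mapping.lookup x i *\<^sub>C g i)"

lemma lin_extend_superset:
  assumes "finite I" "Poly_Mapping.keys x \<subseteq> I"
  shows "lin_extend g x = (\<Sum>i\<in>I. Poly_Mapping.lookup x i *\<^sub>C g i)"
  unfolding lin_extend_def
  by (rule sum.mono_neutral_left) (use assms in \<open>auto simp: in_keys_iff\<close>)

lemma clinear_lin_extend: "clinear (lin_extend g)"
proof (rule clinearI)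
  fix x y :: "'a \<Rightarrow>\<^sub>0 complex" and c :: complex
  let ?I = "Poly_Mapping.keys x \<union> Poly_Mapping.keys y"
  show "lin_extend g (x + y) = lin_extend g x + lin_extend g y"
    by (simp add: lin_extend_superset[of ?I] keys_add lookup_add scaleC_add_left sum.distrib)
  have "Poly_Mapping.keys (c *\<^sub>C x) \<subseteq> Poly_Mapping.keys x"
    by (auto simp: in_keys_iff lookup_scaleC)
  then show "lin_extend g (c *\<^sub>C x) = c *\<^sub>C lin_extend g x"
    by (simp add: lin_extend_superset[of "Poly_Mapping.keys x"] lookup_scaleC
        complex_vector.scale_sum_right scaleC_complex_def)
qed

lemma lin_extend_basis [simp]: "lin_extend g (basis i) = g i"
  by (simp add: lin_extend_def scaleC_one)

lemma lin_extend_basis_id: "lin_extend basis x = x"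
proof (rule poly_mapping_eqI)
  fix k
  have "Poly_Mapping.lookup (lin_extend basis x) k
      = (\<Sum>i\<in>Poly_Mapping.keys x. Poly_Mapping.lookup x i when i = k)"
    unfolding lin_extend_def lookup_sum
    by (intro sum.cong) (auto simp: lookup_scaleC lookup_single scaleC_complex_def when_def)
  also have "\<dots> = Poly_Mapping.lookup x k"
    by (simp add: when_def in_keys_iff)
  finally show "Poly_Mapping.lookup (lin_extend basis x) k = Poly_Mapping.lookup x k" .
qed

lemma clinear_eq_lin_extend:
  assumes "clinear F" shows "F x = lin_extend (\<lambda>i. F (basis i)) x"
proof -
  have "F x = F (lin_extend basis x)" by (simp add: lin_extend_basis_id)
  also have "\<dots> = lin_extend (\<lambda>i. F (basis i)) x"
    by (simp add: lin_extend_def clinear_sum[OF assms] clinear_scale[OF assms])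
  finally show ?thesis .
qed

lemma lin_extend_in_span:
  "(\<And>i. g i \<in> complex_vector.span S) \<Longrightarrow> lin_extend g x \<in> complex_vector.span S"
  unfolding lin_extend_def by (intro complex_vector.span_sum complex_vector.span_scale)


section \<open>Tensor powers\<close>

text \<open>The type \<open>'a tensor\<close> is \<open>\<Oplus>\<^sub>n A\<^sup>\<otimes>\<^sup>n\<close> for \<open>A = 'a\<close>: the free vector space on all lists over
  \<open>A\<close> modulo the multilinearity relations, a list of length \<open>n\<close> standing for
  an elementary tensor of degree \<open>n\<close>. The relations are homogeneous in the length, so the
  component of degree \<open>n\<close> is exactly the tensor power \<open>A\<^sup>\<otimes>\<^sup>n\<close>. The product is that of
  the direct sum of the algebras \<open>A\<^sup>\<otimes>\<^sup>n\<close>, that is factorwise in each degree and zero between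
  different degrees (it is not the concatenation product of the tensor algebra).\<close>

definition tensor_relations :: "('a::complex_comm_algebra list \<Rightarrow>\<^sub>0 complex) set" where
  "tensor_relations =
     {basis (u[i := a + b]) - basis (u[i := a]) - basis (u[i := b]) | u i a b. i < length u} \<union>
     {basis (u[i := c *\<^sub>C a]) - c *\<^sub>C basis (u[i := a]) | u i c a. i < length u}"

definition tensor_equiv ::
  "('a::complex_comm_algebra list \<Rightarrow>\<^sub>0 complex) \<Rightarrow> ('a list \<Rightarrow>\<^sub>0 complex) \<Rightarrow> bool" where
  "tensor_equiv x y \<longleftrightarrow> x - y \<in> complex_vector.span tensor_relations"

lemma equivp_tensor_equiv: "equivp (tensor_equiv :: ('a::complex_comm_algebra list \<Rightarrow>\<^sub>0 complex) \<Rightarrow> _)"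
proof (rule equivpI)
  show "reflp (tensor_equiv :: ('a list \<Rightarrow>\<^sub>0 complex) \<Rightarrow> _)"
    by (simp add: reflp_def tensor_equiv_def complex_vector.span_zero)
  show "symp (tensor_equiv :: ('a list \<Rightarrow>\<^sub>0 complex) \<Rightarrow> _)"
    unfolding symp_def tensor_equiv_def by (metis complex_vector.span_neg minus_diff_eq)
  show "transp (tensor_equiv :: ('a list \<Rightarrow>\<^sub>0 complex) \<Rightarrow> _)"
  proof (rule transpI)
    fix x y z :: "'a list \<Rightarrow>\<^sub>0 complex" assume "tensor_equiv x y" "tensor_equiv y z"
    then have "(x - y) + (y - z) \<in> complex_vector.span tensor_relations"
      unfolding tensor_equiv_def by (rule complex_vector.span_add)
    then show "tensor_equiv x z" by (simp add: tensor_equiv_def)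
  qed
qed

quotient_type (overloaded) 'a tensor = "'a::complex_comm_algebra list \<Rightarrow>\<^sub>0 complex" / tensor_equiv
  by (rule equivp_tensor_equiv)

definition multilinear :: "('a::complex_comm_algebra list \<Rightarrow> 'b::complex_vector) \<Rightarrow> bool" where
  "multilinear g \<longleftrightarrow> (\<forall>u i. i < length u \<longrightarrow> clinear (\<lambda>a. g (u[i := a])))"

lemma multilinearD: "multilinear g \<Longrightarrow> i < length u \<Longrightarrow> clinear (\<lambda>a. g (u[i := a]))"
  by (simp add: multilinear_def)

lemma lin_extend_span_relations:
  assumes "\<And>u i a b. i < length u \<Longrightarrow>
             g (u[i := a + b]) - g (u[i := a]) - g (u[i := b]) \<in> complex_vector.span S"
    and "\<And>u i c a. i < length u \<Longrightarrow>
             g (u[i := c *\<^sub>C a]) - c *\<^sub>C g (u[i := a]) \<in> complex_vector.span S"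
    and "x \<in> complex_vector.span tensor_relations"
  shows "lin_extend g x \<in> complex_vector.span S"
  using assms(3)
proof (induction x rule: complex_vector.span_induct)
  case base
  have "complex_vector.subspace {x. lin_extend g x \<in> complex_vector.span S}"
    by (rule complex_vector.subspaceI)
      (simp_all add: clinear_zero[OF clinear_lin_extend] clinear_add[OF clinear_lin_extend]
        clinear_scale[OF clinear_lin_extend] complex_vector.span_zero
        complex_vector.span_add complex_vector.span_scale)
  then show ?case .
next
  case (step x)
  then show ?case unfolding tensor_relations_def
    using assms(1,2)
    by (auto simp: clinear_diff[OF clinear_lin_extend] clinear_scale[OF clinear_lin_extend])
qed

lemma lin_extend_respects:
  assumes "multilinear g" "tensor_equiv x y" shows "lin_extend g x = lin_extend g y"
proof -
  have "lin_extend g (x - y) \<in> complex_vector.span {}"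
  proof (rule lin_extend_span_relations)
    show "x - y \<in> complex_vector.span tensor_relations"
      using assms(2) by (simp add: tensor_equiv_def)
    fix u :: "'a list" and i a b c assume "i < length u"
    then have "clinear (\<lambda>a. g (u[i := a]))" using assms(1) by (simp add: multilinear_def)
    from clinear_add[OF this] clinear_scale[OF this]
    show "g (u[i := a + b]) - g (u[i := a]) - g (u[i := b]) \<in> complex_vector.span {}"
      and "g (u[i := c *\<^sub>C a]) - c *\<^sub>C g (u[i := a]) \<in> complex_vector.span {}"
      by simp_all
  qed
  then show ?thesis by (simp add: clinear_diff[OF clinear_lin_extend])
qed

text \<open>The elementary tensor of \<open>[a\<^sub>1, \<dots>, a\<^sub>n]\<close>.\<close>
lift_definition tensor_of :: "'a::complex_comm_algebra list \<Rightarrow> 'a tensor" is basis .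

text \<open>The linear map that a multilinear \<open>g\<close> induces; the choice of representative is
  immaterial (lemmas \<open>tensor_lift_tensor_of\<close> and \<open>clinear_tensor_lift\<close> below).\<close>
definition tensor_lift ::
  "('a::complex_comm_algebra list \<Rightarrow> 'b::complex_vector) \<Rightarrow> 'a tensor \<Rightarrow> 'b" where
  "tensor_lift g t = lin_extend g (rep_tensor t)"

instantiation tensor :: (complex_comm_algebra) complex_vector
begin

lift_definition zero_tensor :: "'a tensor" is 0 .

lift_definition plus_tensor :: "'a tensor \<Rightarrow> 'a tensor \<Rightarrow> 'a tensor" is "(+)"
  unfolding tensor_equiv_def by (metis add_diff_add complex_vector.span_add)

lift_definition minus_tensor :: "'a tensor \<Rightarrow> 'a tensor \<Rightarrow> 'a tensor" is "(-)"
proof -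
  fix x x' y y' :: "'a list \<Rightarrow>\<^sub>0 complex" assume "tensor_equiv x x'" "tensor_equiv y y'"
  then have "(x - x') - (y - y') \<in> complex_vector.span tensor_relations"
    unfolding tensor_equiv_def by (rule complex_vector.span_diff)
  then show "tensor_equiv (x - y) (x' - y')" by (simp add: tensor_equiv_def algebra_simps)
qed

lift_definition uminus_tensor :: "'a tensor \<Rightarrow> 'a tensor" is uminus
  unfolding tensor_equiv_def by (metis complex_vector.span_neg minus_diff_minus)

lift_definition scaleC_tensor :: "complex \<Rightarrow> 'a tensor \<Rightarrow> 'a tensor" is scaleC
  unfolding tensor_equiv_def
  by (metis complex_vector.scale_right_diff_distrib complex_vector.span_scale)

instance
  by standard
    (transfer, simp add: tensor_equiv_def complex_vector.span_zero scaleC_add_right scaleC_add_left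
      scaleC_scaleC scaleC_one algebra_simps)+

end

lemma abs_tensor_eq_lin_extend: "abs_tensor x = lin_extend tensor_of x"
proof -
  have "clinear abs_tensor"
    by (rule clinearI) (simp_all add: plus_tensor.abs_eq scaleC_tensor.abs_eq)
  from clinear_eq_lin_extend[OF this] show ?thesis by (metis (no_types, lifting) ext tensor_of.abs_eq)
qed

lemma abs_rep_tensor: "abs_tensor (rep_tensor t) = t"
  by (rule Quotient3_abs_rep[OF Quotient3_tensor])

lemma tensor_eq_lin_extend: "t = lin_extend tensor_of (rep_tensor t)"
  by (simp flip: abs_tensor_eq_lin_extend add: abs_rep_tensor)

lemma multilinear_tensor_of: "multilinear tensor_of"
  unfolding multilinear_def
proof (intro allI impI clinearI)
  fix u :: "'a list" and i c and a b :: 'a assume i: "i < length u"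
  show "tensor_of (u[i := a + b]) = tensor_of (u[i := a]) + tensor_of (u[i := b])"
  proof -
    have "basis (u[i := a + b]) - basis (u[i := a]) - basis (u[i := b]) \<in> tensor_relations"
      using i unfolding tensor_relations_def by blast
    from complex_vector.span_base[OF this]
    show "tensor_of (u[i := a + b]) = tensor_of (u[i := a]) + tensor_of (u[i := b])"
      by (simp add: tensor_of.abs_eq plus_tensor.abs_eq tensor.abs_eq_iff tensor_equiv_def
          diff_diff_eq)
  qed
  show "tensor_of (u[i := c *\<^sub>C a]) = c *\<^sub>C tensor_of (u[i := a])"
  proof -
    have "basis (u[i := c *\<^sub>C a]) - c *\<^sub>C basis (u[i := a]) \<in> tensor_relations"
      using i unfolding tensor_relations_def by blast
    from complex_vector.span_base[OF this]
    show "tensor_of (u[i := c *\<^sub>C a]) = c *\<^sub>C tensor_of (u[i := a])"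
      by (simp add: tensor_of.abs_eq scaleC_tensor.abs_eq tensor.abs_eq_iff tensor_equiv_def)
  qed
qed

lemma tensor_lift_abs: "multilinear g \<Longrightarrow> tensor_lift g (abs_tensor x) = lin_extend g x"
  unfolding tensor_lift_def
  by (rule lin_extend_respects) (assumption, simp add: abs_rep_tensor flip: tensor.abs_eq_iff)

lemma tensor_lift_tensor_of: "multilinear g \<Longrightarrow> tensor_lift g (tensor_of u) = g u"
  by (simp add: tensor_of.abs_eq tensor_lift_abs)

lemma clinear_tensor_lift:
  assumes "multilinear g" shows "clinear (tensor_lift g)"
proof (rule clinearI)
  fix s t :: "'a tensor" and c :: complex
  obtain x y where "s = abs_tensor x" "t = abs_tensor y"
    by (metis abs_rep_tensor)
  then show "tensor_lift g (s + t) = tensor_lift g s + tensor_lift g t"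
    "tensor_lift g (c *\<^sub>C s) = c *\<^sub>C tensor_lift g s"
    by (simp_all add: plus_tensor.abs_eq scaleC_tensor.abs_eq tensor_lift_abs[OF assms]
        clinear_add[OF clinear_lin_extend] clinear_scale[OF clinear_lin_extend])
qed

lemma tensor_clinear_eqI:
  assumes "clinear F" "clinear G" "\<And>u. F (tensor_of u) = G (tensor_of u)"
  shows "F t = G t"
proof -
  have "F (lin_extend tensor_of x) = G (lin_extend tensor_of x)" for x
    by (simp add: lin_extend_def clinear_sum[OF assms(1)] clinear_scale[OF assms(1)]
        clinear_sum[OF assms(2)] clinear_scale[OF assms(2)] assms(3))
  from this[of "rep_tensor t"] show ?thesis by (simp flip: tensor_eq_lin_extend)
qed

definition tensor_power :: "nat \<Rightarrow> 'a::complex_comm_algebra tensor set" where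
  "tensor_power n = complex_vector.span {tensor_of u | u. length u = n}"


subsection \<open>The product\<close>

definition list_times :: "'a::complex_comm_algebra list \<Rightarrow> 'a list \<Rightarrow> 'a tensor" where
  "list_times u v = (if length u = length v then tensor_of (map2 (*) u v) else 0)"

lemma list_times_commute: "list_times u v = list_times v u"
proof -
  have "map2 (*) u v = map2 (*) v u" if "length u = length v"
    using that by (intro nth_equalityI) (auto simp: mult.commute)
  then show ?thesis by (simp add: list_times_def)
qed

lemma multilinear_list_times: "multilinear (list_times u)"
  unfolding multilinear_def
proof (intro allI impI)
  fix v :: "'a list" and i assume i: "i < length v"
  show "clinear (\<lambda>a. list_times u (v[i := a]))"
  proof (cases "length u = length v")
    case True
    have *: "map2 (*) u (v[i := a]) = (map2 (*) u v)[i := u ! i * a]" for a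
      using True i by (intro nth_equalityI) (auto simp: nth_list_update)
    have lin: "clinear (\<lambda>a. tensor_of ((map2 (*) u v)[i := a]))"
      using i True by (intro multilinearD[OF multilinear_tensor_of]) simp
    show ?thesis
      by (rule clinearI)
        (simp_all add: list_times_def True * distrib_left scaleC_mult_right
          clinear_add[OF lin] clinear_scale[OF lin])
  next
    case False
    then show ?thesis by (intro clinearI) (simp_all add: list_times_def)
  qed
qed

lemma multilinear_list_times_left: "multilinear (\<lambda>u. list_times u v)"
proof -
  have "(\<lambda>u. list_times u v) = list_times v" by (rule ext) (rule list_times_commute)
  then show ?thesis by (simp add: multilinear_list_times)
qed

lemma multilinear_lin_extend:
  fixes g :: "'a::complex_comm_algebra list \<Rightarrow> 'i \<Rightarrow> 'b::complex_vector"
  assumes "\<And>v. multilinear (\<lambda>u. g u v)"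
  shows "multilinear (\<lambda>u. lin_extend (g u) y)"
  unfolding multilinear_def
proof (intro allI impI clinearI)
  fix u :: "'a list" and i c a b assume "i < length u"
  then have lin: "clinear (\<lambda>a. g (u[i := a]) v)" for v using assms by (simp add: multilinear_def)
  show "lin_extend (g (u[i := a + b])) y = lin_extend (g (u[i := a])) y + lin_extend (g (u[i := b])) y"
    "lin_extend (g (u[i := c *\<^sub>C a])) y = c *\<^sub>C lin_extend (g (u[i := a])) y"
    by (simp_all add: lin_extend_def clinear_add[OF lin] clinear_scale[OF lin] scaleC_add_right
        sum.distrib complex_vector.scale_sum_right scaleC_scaleC mult.commute)
qed

instantiation tensor :: (complex_comm_algebra) times
begin

text \<open>The bilinear extension of \<open>(a\<^sub>1 \<otimes> \<dots> \<otimes> a\<^sub>n) (b\<^sub>1 \<otimes> \<dots> \<otimes> b\<^sub>n) = a\<^sub>1 b\<^sub>1 \<otimes> \<dots> \<otimes> a\<^sub>n b\<^sub>n\<close>.\<close>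
definition times_tensor :: "'a tensor \<Rightarrow> 'a tensor \<Rightarrow> 'a tensor" where
  "s * t = tensor_lift (\<lambda>u. tensor_lift (\<lambda>v. list_times u v) t) s"

instance ..

end

lemma clinear_times_tensor_left: "clinear (\<lambda>s. s * t)" for t :: "'a::complex_comm_algebra tensor"
proof -
  have "multilinear (\<lambda>u. tensor_lift (\<lambda>v. list_times u v) t)"
    unfolding tensor_lift_def
    by (rule multilinear_lin_extend) (rule multilinear_list_times_left)
  from clinear_tensor_lift[OF this] show ?thesis by (simp add: times_tensor_def)
qed

lemma tensor_of_times: "tensor_of u * t = tensor_lift (list_times u) t"
proof -
  have "multilinear (\<lambda>u. tensor_lift (\<lambda>v. list_times u v) t)"
    unfolding tensor_lift_def
    by (rule multilinear_lin_extend) (rule multilinear_list_times_left)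
  from tensor_lift_tensor_of[OF this] show ?thesis by (simp add: times_tensor_def)
qed

lemma tensor_of_times_tensor_of: "tensor_of u * tensor_of v = list_times u v"
  by (simp add: tensor_of_times tensor_lift_tensor_of multilinear_list_times)

lemma times_tensor_commute: "s * t = t * s" for s t :: "'a::complex_comm_algebra tensor"
proof -
  have *: "clinear (\<lambda>t. tensor_of u * t)" for u :: "'a list"
    unfolding tensor_of_times by (simp add: clinear_tensor_lift multilinear_list_times)
  have 1: "tensor_of u * t = t * tensor_of u" for u and t :: "'a tensor"
    by (rule tensor_clinear_eqI[OF * clinear_times_tensor_left])
      (metis tensor_of_times_tensor_of list_times_commute)
  have **: "clinear (\<lambda>t. s * t)"
  proof (rule clinearI)
    fix x y :: "'a tensor" and c
    show "s * (x + y) = s * x + s * y"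
    proof (rule tensor_clinear_eqI[of "\<lambda>s. s * (x + y)" "\<lambda>s. s * x + s * y"])
      show "clinear (\<lambda>s. s * x + s * y)"
        by (rule clinearI)
          (simp_all add: clinear_add[OF clinear_times_tensor_left]
            clinear_scale[OF clinear_times_tensor_left] scaleC_add_right)
    qed (simp_all add: clinear_times_tensor_left clinear_add[OF *])
    show "s * (c *\<^sub>C x) = c *\<^sub>C (s * x)"
    proof (rule tensor_clinear_eqI[of "\<lambda>s. s * (c *\<^sub>C x)" "\<lambda>s. c *\<^sub>C (s * x)"])
      show "clinear (\<lambda>s. c *\<^sub>C (s * x))"
        by (rule clinearI)
          (simp_all add: clinear_add[OF clinear_times_tensor_left]
            clinear_scale[OF clinear_times_tensor_left] scaleC_add_right scaleC_scaleC mult.commute)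
    qed (simp_all add: clinear_times_tensor_left clinear_scale[OF *])
  qed
  show ?thesis
    by (rule tensor_clinear_eqI[OF ** clinear_times_tensor_left]) (simp add: 1)
qed

instance tensor :: (complex_comm_algebra) comm_ring
proof
  fix a b c :: "'a tensor"
  show "(a + b) * c = a * c + b * c" by (rule clinear_add[OF clinear_times_tensor_left])
  show "a * b = b * a" by (rule times_tensor_commute)
  have right: "clinear (\<lambda>t. s * t)" for s :: "'a tensor"
    using clinear_times_tensor_left[of s] by (simp add: times_tensor_commute[of s])
  note lin = clinear_add[OF clinear_times_tensor_left] clinear_scale[OF clinear_times_tensor_left]
    clinear_add[OF right] clinear_scale[OF right]
  have 0: "0 * t = 0" "t * 0 = 0" for t :: "'a tensor"
    by (simp_all add: clinear_zero[OF clinear_times_tensor_left] clinear_zero[OF right])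
  have pure: "tensor_of u * tensor_of v * tensor_of w = tensor_of u * (tensor_of v * tensor_of w)"
    for u v w :: "'a list"
  proof -
    have "map2 (*) (map2 (*) u v) w = map2 (*) u (map2 (*) v w)"
      if "length u = length v" "length v = length w"
      using that by (intro nth_equalityI) (simp_all add: mult.assoc)
    then show ?thesis
      by (auto simp: tensor_of_times_tensor_of list_times_def 0)
  qed
  have 1: "tensor_of u * tensor_of v * t = tensor_of u * (tensor_of v * t)"
    for u v and t :: "'a tensor"
    by (rule tensor_clinear_eqI[of "\<lambda>t. tensor_of u * tensor_of v * t"
          "\<lambda>t. tensor_of u * (tensor_of v * t)"])
      (auto intro!: clinearI simp: lin pure)
  have 2: "tensor_of u * s * t = tensor_of u * (s * t)" for u and s t :: "'a tensor"
    by (rule tensor_clinear_eqI[of "\<lambda>s. tensor_of u * s * t" "\<lambda>s. tensor_of u * (s * t)"])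
      (auto intro!: clinearI simp: lin 1)
  show "a * b * c = a * (b * c)"
    by (rule tensor_clinear_eqI[of "\<lambda>a. a * b * c" "\<lambda>a. a * (b * c)"])
      (auto intro!: clinearI simp: lin 2)
qed

definition tensor_one :: "nat \<Rightarrow> 'a::complex_comm_algebra tensor" where
  "tensor_one n = tensor_of (replicate n 1)"

lemma tensor_one_times:
  assumes "t \<in> tensor_power n" shows "tensor_one n * t = t"
  using assms unfolding tensor_power_def
proof (induction t rule: complex_vector.span_induct)
  case base
  have "clinear (\<lambda>t. tensor_one n * t :: 'a tensor)"
    using clinear_times_tensor_left[of "tensor_one n"] by (simp add: mult.commute[of "tensor_one n"])
  from clinear_scale[OF this] show ?case
    by (intro complex_vector.subspaceI) (simp_all add: distrib_left)
next
  case (step t)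
  then obtain u where u: "t = tensor_of u" "length u = n" by auto
  have "map2 (*) (replicate n 1) u = u" using u by (intro nth_equalityI) auto
  then show ?case
    using u by (simp add: tensor_one_def tensor_of_times_tensor_of list_times_def)
qed


subsection \<open>Symmetric tensors\<close>

text \<open>The action of a permutation of \<open>{0..<n}\<close> on \<open>A\<^sup>\<otimes>\<^sup>n\<close>; components in other degrees
  are discarded.\<close>
definition permute_tensor ::
  "nat \<Rightarrow> (nat \<Rightarrow> nat) \<Rightarrow> 'a::complex_comm_algebra tensor \<Rightarrow> 'a tensor" where
  "permute_tensor n \<sigma> = tensor_lift (\<lambda>u. if length u = n then tensor_of (permute_list \<sigma> u) else 0)"

definition symmetric_tensors :: "nat \<Rightarrow> 'a::complex_comm_algebra tensor set" where
  "symmetric_tensors n =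
     {t \<in> tensor_power n. \<forall>\<sigma>. \<sigma> permutes {..<n} \<longrightarrow> permute_tensor n \<sigma> t = t}"

lemma multilinear_permute_list:
  assumes "\<sigma> permutes {..<n}"
  shows "multilinear (\<lambda>u. if length u = n then tensor_of (permute_list \<sigma> u) else 0)"
  unfolding multilinear_def
proof (intro allI impI)
  fix u :: "'a list" and i assume i: "i < length u"
  show "clinear (\<lambda>a. if length (u[i := a]) = n then tensor_of (permute_list \<sigma> (u[i := a])) else 0)"
  proof (cases "length u = n")
    case True
    let ?j = "inv \<sigma> i"
    have j: "?j < n" using permutes_in_image[OF permutes_inv[OF assms], of i] i True by simp
    have "permute_list \<sigma> (u[i := a]) = (permute_list \<sigma> u)[?j := a]" for a
    proof (rule nth_equalityI)
      fix k assume "k < length (permute_list \<sigma> (u[i := a]))"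
      then have k: "k < n" "\<sigma> k < n"
        using True permutes_in_image[OF assms, of k] by auto
      have "?j = k \<longleftrightarrow> i = \<sigma> k" using permutes_inv_eq[OF assms] by auto
      then show "permute_list \<sigma> (u[i := a]) ! k = (permute_list \<sigma> u)[?j := a] ! k"
        using k True by (auto simp: permute_list_def nth_list_update)
    qed simp
    moreover have "clinear (\<lambda>a. tensor_of ((permute_list \<sigma> u)[?j := a]))"
      using j True by (intro multilinearD[OF multilinear_tensor_of]) simp
    ultimately show ?thesis using True by simp
  next
    case False
    then show ?thesis by (intro clinearI) simp_all
  qed
qed

lemma permute_tensor_tensor_of:
  assumes "\<sigma> permutes {..<n}" "length u = n"
  shows "permute_tensor n \<sigma> (tensor_of u) = tensor_of (permute_list \<sigma> u)"
  using assms by (simp add: permute_tensor_def tensor_lift_tensor_of multilinear_permute_list)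

lemma clinear_permute_tensor: "\<sigma> permutes {..<n} \<Longrightarrow> clinear (permute_tensor n \<sigma>)"
  by (simp add: permute_tensor_def clinear_tensor_lift multilinear_permute_list)

lemma tensor_power_eqI:
  assumes "clinear F" "clinear G" "\<And>u. length u = n \<Longrightarrow> F (tensor_of u) = G (tensor_of u)"
    and "t \<in> tensor_power n"
  shows "F t = G t"
  using assms(4) unfolding tensor_power_def
proof (induction t rule: complex_vector.span_induct)
  case base
  show ?case
    by (rule complex_vector.subspaceI)
      (simp_all add: clinear_zero[OF assms(1)] clinear_zero[OF assms(2)] clinear_add[OF assms(1)]
        clinear_add[OF assms(2)] clinear_scale[OF assms(1)] clinear_scale[OF assms(2)])
qed (use assms(3) in auto)

lemma clinear_times_tensor_right: "clinear (\<lambda>t. s * t)" for s :: "'a::complex_comm_algebra tensor"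
  using clinear_times_tensor_left[of s] by (simp add: mult.commute[of s])

lemma tensor_power_times:
  assumes "s \<in> tensor_power n" "t \<in> tensor_power n" shows "s * t \<in> tensor_power n"
proof -
  have *: "tensor_of u * t \<in> tensor_power n" if "length u = n" for u
    using assms(2) unfolding tensor_power_def
  proof (induction t rule: complex_vector.span_induct)
    case base
    show ?case
      by (rule complex_vector.subspaceI)
        (simp_all add: distrib_left clinear_scale[OF clinear_times_tensor_right]
          complex_vector.span_zero complex_vector.span_add complex_vector.span_scale)
  next
    case (step t)
    then obtain v where "t = tensor_of v" "length v = n" by auto
    then show ?case
      using that by (auto simp: tensor_of_times_tensor_of list_times_def
          intro!: complex_vector.span_base)
  qed
  show ?thesis
    using assms(1) unfolding tensor_power_def
  proof (induction s rule: complex_vector.span_induct)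
    case base
    show ?case
      by (rule complex_vector.subspaceI)
        (simp_all add: distrib_right clinear_scale[OF clinear_times_tensor_left]
          complex_vector.span_zero complex_vector.span_add complex_vector.span_scale)
  next
    case (step s)
    then obtain u where "s = tensor_of u" "length u = n" by auto
    with * show ?case by (simp add: tensor_power_def)
  qed
qed

lemma permute_tensor_times:
  assumes \<sigma>: "\<sigma> permutes {..<n}" and s: "s \<in> tensor_power n" and t: "t \<in> tensor_power n"
  shows "permute_tensor n \<sigma> (s * t) = permute_tensor n \<sigma> s * permute_tensor n \<sigma> t"
proof -
  note lin = clinear_add[OF clinear_permute_tensor[OF \<sigma>]]
    clinear_scale[OF clinear_permute_tensor[OF \<sigma>]]
    clinear_scale[OF clinear_times_tensor_left] clinear_scale[OF clinear_times_tensor_right]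
  have pure: "permute_tensor n \<sigma> (tensor_of u * tensor_of v)
      = permute_tensor n \<sigma> (tensor_of u) * permute_tensor n \<sigma> (tensor_of v)"
    if "length u = n" "length v = n" for u v :: "'a list"
  proof -
    have "permute_list \<sigma> (map2 (*) u v) = map2 (*) (permute_list \<sigma> u) (permute_list \<sigma> v)"
      using that permutes_in_image[OF \<sigma>]
      by (intro nth_equalityI) (auto simp: permute_list_def)
    then show ?thesis
      using that by (simp add: tensor_of_times_tensor_of list_times_def
          permute_tensor_tensor_of[OF \<sigma>])
  qed
  have 1: "permute_tensor n \<sigma> (tensor_of u * t)
      = permute_tensor n \<sigma> (tensor_of u) * permute_tensor n \<sigma> t" if "length u = n" for u
    by (rule tensor_power_eqI[of "\<lambda>t. permute_tensor n \<sigma> (tensor_of u * t)"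
          "\<lambda>t. permute_tensor n \<sigma> (tensor_of u) * permute_tensor n \<sigma> t", OF _ _ _ t])
      (auto intro!: clinearI simp: lin distrib_left pure that)
  show ?thesis
    by (rule tensor_power_eqI[of "\<lambda>s. permute_tensor n \<sigma> (s * t)"
          "\<lambda>s. permute_tensor n \<sigma> s * permute_tensor n \<sigma> t", OF _ _ _ s])
      (auto intro!: clinearI simp: lin distrib_right 1)
qed

lemma symmetric_tensors_subalgebra:
  fixes n :: nat
  defines "S \<equiv> symmetric_tensors n :: 'a::complex_comm_algebra tensor set"
  shows "tensor_one n \<in> S" "complex_vector.subspace S" "\<lbrakk>s \<in> S; t \<in> S\<rbrakk> \<Longrightarrow> s * t \<in> S"
proof -
  have "permute_list \<sigma> (replicate n (1::'a)) = replicate n 1" if "\<sigma> permutes {..<n}" for \<sigma>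
    using permutes_in_image[OF that] by (intro nth_equalityI) (auto simp: permute_list_def)
  moreover have "tensor_one n \<in> (tensor_power n :: 'a tensor set)"
    by (auto simp: tensor_power_def tensor_one_def intro!: complex_vector.span_base)
  ultimately show "tensor_one n \<in> S"
    by (simp add: S_def symmetric_tensors_def tensor_one_def permute_tensor_tensor_of)
  have "complex_vector.subspace (tensor_power n :: 'a tensor set)"
    by (simp add: tensor_power_def)
  then show "complex_vector.subspace S"
    unfolding S_def symmetric_tensors_def complex_vector.subspace_def
    by (auto simp: clinear_zero[OF clinear_permute_tensor] clinear_add[OF clinear_permute_tensor]
        clinear_scale[OF clinear_permute_tensor])
  show "\<lbrakk>s \<in> S; t \<in> S\<rbrakk> \<Longrightarrow> s * t \<in> S"
    unfolding S_def symmetric_tensors_def by (auto simp: tensor_power_times permute_tensor_times)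
qed


section \<open>Frobenius homomorphisms\<close>

text \<open>For \<open>\<sigma>\<close> permuting \<open>{0..<n}\<close> the set \<^term>\<open>orbit \<sigma> ` {..<n}\<close> consists of the supports
  of the disjoint cycles of \<open>\<sigma>\<close>, fixed points included. As \<open>A\<close> is commutative,
  \<open>f(a\<^bsub>i\<^sub>1\<^esub> \<cdots> a\<^bsub>i\<^sub>m\<^esub>)\<close> only depends on the support of the cycle \<open>(i\<^sub>1 \<dots> i\<^sub>m)\<close>.\<close>
definition Phi_list ::
  "('a::complex_comm_algebra \<Rightarrow> 'b::complex_comm_algebra) \<Rightarrow> 'a list \<Rightarrow> 'b" where
  "Phi_list f u = (\<Sum>\<sigma> | \<sigma> permutes {..<length u}.
     of_int (sign \<sigma>) *\<^sub>C (\<Prod>\<gamma>\<in>orbit \<sigma> ` {..<length u}. f (\<Prod>i\<in>\<gamma>. u ! i)))"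

text \<open>The linear map on \<open>A\<^sup>\<otimes>\<^sup>n\<close>, extended by zero to the other degrees (see the lemmas
  \<open>clinear_Phi\<close> and \<open>Phi_tensor_of\<close>).\<close>
definition Phi ::
  "nat \<Rightarrow> ('a::complex_comm_algebra \<Rightarrow> 'b::complex_comm_algebra) \<Rightarrow> 'a tensor \<Rightarrow> 'b" where
  "Phi n f = tensor_lift (\<lambda>u. if length u = n then Phi_list f u else 0)"

definition frobenius_hom ::
  "nat \<Rightarrow> ('a::complex_comm_algebra \<Rightarrow> 'b::complex_comm_algebra) \<Rightarrow> bool" where
  "frobenius_hom n f \<longleftrightarrow>
     clinear f \<and> f 1 = of_nat n *\<^sub>C 1 \<and> (\<forall>t\<in>tensor_power (Suc n). Phi (Suc n) f t = 0)"

text \<open>A unital ring homomorphism from a ring \<open>S\<close> with unit \<open>e\<close>, embedded without unit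
  in the ambient ring \<open>'r\<close>.\<close>
definition ring_hom_on ::
  "'r::comm_ring set \<Rightarrow> 'r \<Rightarrow> ('r \<Rightarrow> 'b::complex_comm_algebra) \<Rightarrow> bool" where
  "ring_hom_on S e h \<longleftrightarrow>
     h e = 1 \<and> (\<forall>s\<in>S. \<forall>t\<in>S. h (s + t) = h s + h t \<and> h (s * t) = h s * h t)"

lemma multilinear_Phi_list:
  fixes f :: "'a::complex_comm_algebra \<Rightarrow> 'b::complex_comm_algebra"
  assumes "clinear f"
  shows "multilinear (\<lambda>u. if length u = n then Phi_list f u else 0)"
  unfolding multilinear_def
proof (intro allI impI)
  fix u :: "'a list" and i assume i: "i < length u"
  show "clinear (\<lambda>a. if length (u[i := a]) = n then Phi_list f (u[i := a]) else 0)"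
  proof (cases "length u = n")
    case True
    have lin: "clinear (\<lambda>a. \<Prod>\<gamma>\<in>orbit \<sigma> ` {..<n}. f (\<Prod>j\<in>\<gamma>. u[i := a] ! j))"
      if \<sigma>: "\<sigma> permutes {..<n}" for \<sigma>
    proof -
      have perm: "permutation \<sigma>" using \<sigma> permutation_permutes by blast
      have iorb: "i \<in> orbit \<sigma> i" by (rule permutation_self_in_orbit[OF perm])
      have sub: "orbit \<sigma> k \<subseteq> {..<n}" if "k < n" for k
        by (rule permutes_orbit_subset[OF \<sigma>]) (simp add: that)
      have other: "i \<notin> \<gamma>" if "\<gamma> \<in> orbit \<sigma> ` {..<n} - {orbit \<sigma> i}" for \<gamma>
      proof
        assume "i \<in> \<gamma>"
        moreover from that obtain k where k: "\<gamma> = orbit \<sigma> k" by blast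
        ultimately have "i \<in> orbit \<sigma> k" by simp
        then have "orbit \<sigma> k = orbit \<sigma> i"
          by (rule orbit_cyclic_eq3[OF cyclic_on_orbit'[OF perm], symmetric])
        then show False using that k by simp
      qed
      have fin: "finite (orbit \<sigma> i)" by (rule finite_subset[OF sub[of i]]) (use i True in auto)
      define P where "P = (\<Prod>j\<in>orbit \<sigma> i - {i}. u ! j)"
      define Q where "Q = (\<Prod>\<gamma>\<in>orbit \<sigma> ` {..<n} - {orbit \<sigma> i}. f (\<Prod>j\<in>\<gamma>. u ! j))"
      have "(\<Prod>\<gamma>\<in>orbit \<sigma> ` {..<n}. f (\<Prod>j\<in>\<gamma>. u[i := a] ! j)) = f (a * P) * Q" for a
      proof -
        have "(\<Prod>j\<in>orbit \<sigma> i. u[i := a] ! j) = a * P"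
          unfolding P_def by (subst prod.remove[OF fin iorb]) (use i in \<open>auto intro!: prod.cong\<close>)
        moreover have "(\<Prod>\<gamma>\<in>orbit \<sigma> ` {..<n} - {orbit \<sigma> i}. f (\<Prod>j\<in>\<gamma>. u[i := a] ! j)) = Q"
          unfolding Q_def
        proof (rule prod.cong[OF refl])
          fix \<gamma> assume "\<gamma> \<in> orbit \<sigma> ` {..<n} - {orbit \<sigma> i}"
          from other[OF this] show "f (\<Prod>j\<in>\<gamma>. u[i := a] ! j) = f (\<Prod>j\<in>\<gamma>. u ! j)"
            by (intro arg_cong[where f = f] prod.cong refl) (metis nth_list_update_neq)
        qed
        ultimately show ?thesis
          using i True by (subst prod.remove[of _ "orbit \<sigma> i"]) auto
      qed
      then show ?thesis
        by (intro clinearI)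
          (simp_all add: distrib_right scaleC_mult_left clinear_add[OF assms] clinear_scale[OF assms])
    qed
    show ?thesis
      using True
      by (intro clinearI)
        (simp_all add: Phi_list_def clinear_add[OF lin] clinear_scale[OF lin] scaleC_add_right
          sum.distrib complex_vector.scale_sum_right scaleC_scaleC mult.commute)
  next
    case False
    then show ?thesis by (intro clinearI) simp_all
  qed
qed

lemma clinear_Phi: "clinear f \<Longrightarrow> clinear (Phi n f)"
  by (simp add: Phi_def clinear_tensor_lift multilinear_Phi_list)

lemma Phi_tensor_of: "clinear f \<Longrightarrow> length u = n \<Longrightarrow> Phi n f (tensor_of u) = Phi_list f u"
  by (simp add: Phi_def tensor_lift_tensor_of multilinear_Phi_list)

end

theory Submission
  imports Defs
begin

text \<open>Sorting the permutations of \<open>{0, \<dots>, m}\<close> by the position of \<open>0\<close> gives the recursion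
  \<open>\<Phi>(a\<^sub>0, \<dots>, a\<^sub>m) = f(a\<^sub>0) \<Phi>(a\<^sub>1, \<dots>, a\<^sub>m) - \<Sum>\<^sub>i \<Phi>(a\<^sub>1, \<dots>, a\<^sub>0 a\<^sub>i, \<dots>, a\<^sub>m)\<close>. Thus
  \<open>\<Phi>\<^bsub>n+1\<^esub> = 0\<close> says that multiplying \<open>\<Phi>\<^sub>n\<close> by \<open>f(a)\<close> amounts to multiplying its arguments by \<open>a\<close>,
  one at a time. If this holds, the recursion turns \<open>\<Phi>\<^sub>k(u) \<Phi>\<^sub>n(v)\<close> by induction on \<open>k\<close> into the sum,
  over the injections of \<open>{1, \<dots>, k}\<close> into \<open>{1, \<dots>, n}\<close>, of the values of \<open>\<Phi>\<^sub>n\<close> at \<open>v\<close> multiplied by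
  \<open>u\<close> along the injection: the terms in which two factors of \<open>u\<close> meet cancel. For \<open>k = n\<close> the right
  hand side is \<open>\<Phi>\<^sub>n\<close> of the product of the symmetrization of \<open>u\<close> with \<open>v\<close>. Conversely,
  \<open>\<Phi>\<^bsub>n+1\<^esub> = 0\<close> is the multiplicativity of \<open>\<Phi>\<^sub>n/n!\<close> on \<open>\<Sum>\<^sub>j 1 \<otimes> \<dots> \<otimes> a \<otimes> \<dots> \<otimes> 1\<close> times a symmetrized
  elementary tensor, since \<open>\<Phi>\<^sub>n/n!\<close> takes the first factor to \<open>f(a)\<close> when \<open>f(1) = n\<close>.\<close>

section \<open>Inserting a point into a permutation\<close>

text \<open>\<open>p\<close> sends \<open>a\<close> to \<open>b\<close> and the
  \<open>q\<close>-preimage of \<open>b\<close> to \<open>a\<close>, and agrees with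
  \<open>q\<close> elsewhere on \<open>I\<close>: it splices \<open>a\<close> into the cycle of
  \<open>b\<close>, just before \<open>b\<close>.\<close>

lemma orbit_insert_transpose:
  assumes q: "q permutes I" and fin: "finite I" and a: "a \<notin> I" and b: "b \<in> I"
  defines "p \<equiv> transpose a b \<circ> q"
  shows "orbit p ` insert a I = insert (insert a (orbit q b)) (orbit q ` I - {orbit q b})"
proof -
  have perm_q: "permutation q"
    using q fin permutation_permutes by blast
  have perm_p: "permutation p"
    unfolding p_def by (intro permutation_compose permutation_swap_id perm_q)
  have cyc_p: "orbit p y = orbit p x" if "y \<in> orbit p x" for x y
    by (rule orbit_cyclic_eq3[OF cyclic_on_orbit'[OF perm_p] that])
  have cyc_q: "orbit q y = orbit q x" if "y \<in> orbit q x" for x y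
    by (rule orbit_cyclic_eq3[OF cyclic_on_orbit'[OF perm_q] that])
  have q_ne: "q y \<noteq> a" if "y \<in> I" for y
    using permutes_in_image[OF q, of y] that a by auto
  have pa: "p a = b"
    using permutes_not_in[OF q a] by (simp add: p_def)
  have p_b: "p y = a" if "q y = b" for y
    using that by (simp add: p_def)
  have p_q: "p y = q y" if "y \<in> I" "q y \<noteq> b" for y
    using that q_ne by (simp add: p_def)
  have sub: "orbit q x \<subseteq> I" if "x \<in> I" for x
    by (rule permutes_orbit_subset[OF q that])
  have b_self: "b \<in> orbit q b"
    by (rule permutation_self_in_orbit[OF perm_q])
  have orbit_a: "orbit p a = insert a (orbit q b)"
  proof (intro equalityI subsetI)
    fix y assume "y \<in> orbit p a"
    then show "y \<in> insert a (orbit q b)"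
    proof induction
      case base
      then show ?case using pa b_self by simp
    next
      case (step y)
      show ?case
      proof (cases "y = a")
        case True
        then show ?thesis using pa b_self by simp
      next
        case False
        then have y: "y \<in> orbit q b" using step by simp
        then show ?thesis
          using p_b[of y] p_q[of y] sub[OF b] orbit.step[OF y] by (cases "q y = b") auto
      qed
    qed
  next
    have a_self: "a \<in> orbit p a"
      by (rule permutation_self_in_orbit[OF perm_p])
    have b_in: "b \<in> orbit p a"
      using orbit.base[of p a] pa by simp
    \<comment> \<open>Where \<open>q\<close> steps to \<open>b\<close>, \<open>p\<close> detours
      through \<open>a\<close>, but \<open>b\<close> is already known to be in the orbit.\<close>
    have next_in: "q y \<in> orbit p a" if "y \<in> orbit p a" "y \<in> I" for y
      using orbit.step[OF that(1)] b_in p_q[OF that(2)] by (cases "q y = b") auto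
    fix y assume "y \<in> insert a (orbit q b)"
    then consider "y = a" | "y \<in> orbit q b" by auto
    then show "y \<in> orbit p a"
    proof cases
      case 2
      then show ?thesis
      proof induction
        case base
        show ?case by (rule next_in[OF b_in b])
      next
        case (step y)
        then show ?case using next_in sub[OF b] by auto
      qed
    qed (use a_self in simp)
  qed
  have orbit_other: "orbit p x = orbit q x" if x: "x \<in> I" "x \<notin> orbit q b" for x
  proof -
    \<comment> \<open>This orbit never meets \<open>b\<close>, so \<open>p\<close> and
      \<open>q\<close> agree along it.\<close>
    have nb: "y \<noteq> b" if "y \<in> orbit q x" for y
      using cyc_q[OF that] permutation_self_in_orbit[OF perm_q, of x] x(2) by auto
    have x_self: "x \<in> orbit q x"
      by (rule permutation_self_in_orbit[OF perm_q])
    have eq: "p y = q y" if "y \<in> orbit q x" for y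
      using p_q[of y] nb[OF orbit.step[OF that]] sub[OF x(1)] that by auto
    show ?thesis
    proof (intro equalityI subsetI)
      fix y assume "y \<in> orbit p x"
      then show "y \<in> orbit q x"
        by induction (auto simp: eq x_self intro: orbit.intros)
    next
      fix y assume "y \<in> orbit q x"
      then show "y \<in> orbit p x"
      proof induction
        case base
        show ?case using eq[OF x_self] orbit.base[of p x] by simp
      next
        case (step y)
        then show ?case using eq[of y] orbit.step[of y p x] by simp
      qed
    qed
  qed
  have "orbit p x \<in> insert (insert a (orbit q b)) (orbit q ` I - {orbit q b})"
    if "x \<in> insert a I" for x
  proof (cases "x \<in> insert a (orbit q b)")
    case True
    then show ?thesis using cyc_p[of x a] orbit_a by simp
  next
    case False
    then show ?thesis
      using that orbit_other[of x] permutation_self_in_orbit[OF perm_q, of x] by auto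
  qed
  moreover have "orbit q x \<in> orbit p ` insert a I" if "x \<in> I" "orbit q x \<noteq> orbit q b" for x
  proof -
    have "orbit p x = orbit q x"
      using that cyc_q[of x b] by (intro orbit_other) auto
    then show ?thesis using that by (metis imageI insertI2)
  qed
  ultimately show ?thesis
    using orbit_a by (auto simp del: image_insert)
qed


section \<open>The maps Phi on indexed families\<close>

text \<open>An arbitrary index set lets inductions remove one index without renumbering the others;
  \<open>Phi_list\<close> is the case of list positions.\<close>

definition Phi_family ::
  "('a::complex_comm_algebra \<Rightarrow> 'b::complex_comm_algebra) \<Rightarrow> 'i set \<Rightarrow> ('i \<Rightarrow> 'a) \<Rightarrow> 'b" where
  "Phi_family f I w = (\<Sum>\<sigma> | \<sigma> permutes I.
     of_int (sign \<sigma>) *\<^sub>C (\<Prod>\<gamma>\<in>orbit \<sigma> ` I. f (\<Prod>i\<in>\<gamma>. w i)))"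

lemma Phi_family_empty: "Phi_family f {} w = 1"
  by (simp add: Phi_family_def scaleC_one)

text \<open>A permutation of \<open>insert a I\<close> either fixes \<open>a\<close>, or arises from a permutation of
  \<open>I\<close> by putting \<open>a\<close> in front of some \<open>b \<in> I\<close> in the cycle of \<open>b\<close>.\<close>
lemma Phi_family_insert:
  fixes f :: "'a::complex_comm_algebra \<Rightarrow> 'b::complex_comm_algebra"
  assumes fin: "finite I" and a: "a \<notin> I"
  shows "Phi_family f (insert a I) w
    = f (w a) * Phi_family f I w - (\<Sum>b\<in>I. Phi_family f I (w(b := w a * w b)))"
proof -
  let ?F = "\<lambda>p J w. of_int (sign p) *\<^sub>C (\<Prod>\<gamma>\<in>orbit p ` J. f (\<Prod>i\<in>\<gamma>. w i))"
  \<comment> \<open>\<open>transpose a a\<close> is the identity, so \<open>a\<close> is a fixed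
    point and contributes the factor \<open>f (w a)\<close>.\<close>
  have fixed: "?F (transpose a a \<circ> q) (insert a I) w = f (w a) * ?F q I w" if q: "q permutes I" for q
  proof -
    have "orbit q a = {a}"
      using permutes_not_in[OF q a] by (simp add: orbit_eq_singleton_iff)
    moreover have "{a} \<notin> orbit q ` I"
      using permutes_orbit_subset[OF q] a by blast
    ultimately show ?thesis
      using fin by (simp add: scaleC_mult_right)
  qed
  \<comment> \<open>The transposition flips the sign; the product over the cycle enlarged by
    \<open>a\<close> is the one over the old cycle with \<open>w a\<close> absorbed into the entry
    at \<open>b\<close>.\<close>
  have moved: "?F (transpose a b \<circ> q) (insert a I) w = - ?F q I (w(b := w a * w b))"
    if q: "q permutes I" and b: "b \<in> I" for q b
  proof -
    let ?p = "transpose a b \<circ> q" and ?w = "w(b := w a * w b)"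
    have perm: "permutation q"
      using q fin permutation_permutes by blast
    have ab: "a \<noteq> b" using a b by blast
    have sgn: "sign ?p = - sign q"
      using ab by (simp add: sign_compose permutation_swap_id perm sign_swap_id)
    have sub: "orbit q x \<subseteq> I" if "x \<in> I" for x
      by (rule permutes_orbit_subset[OF q that])
    have b_self: "b \<in> orbit q b"
      by (rule permutation_self_in_orbit[OF perm])
    have finb: "finite (orbit q b)"
      using sub[OF b] fin finite_subset by blast
    have anb: "a \<notin> orbit q b" using sub[OF b] a by blast
    \<comment> \<open>Orbits are collected in a set, so the enlarged cycle must differ from the
      others for its factor to split off.\<close>
    have "insert a (orbit q b) \<notin> orbit q ` I"
      using sub a by blast
    then have "(\<Prod>\<gamma>\<in>orbit ?p ` insert a I. f (\<Prod>i\<in>\<gamma>. w i))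
        = f (\<Prod>i\<in>insert a (orbit q b). w i) * (\<Prod>\<gamma>\<in>orbit q ` I - {orbit q b}. f (\<Prod>i\<in>\<gamma>. w i))"
      unfolding orbit_insert_transpose[OF q fin a b] using fin by (subst prod.insert) auto
    also have "(\<Prod>i\<in>insert a (orbit q b). w i) = (\<Prod>i\<in>orbit q b. ?w i)"
    proof -
      have "(\<Prod>i\<in>orbit q b. ?w i) = ?w b * (\<Prod>i\<in>orbit q b - {b}. ?w i)"
        by (rule prod.remove[OF finb b_self])
      also have "(\<Prod>i\<in>orbit q b - {b}. ?w i) = (\<Prod>i\<in>orbit q b - {b}. w i)"
        by (rule prod.cong) auto
      also have "?w b * (\<Prod>i\<in>orbit q b - {b}. w i) = w a * (\<Prod>i\<in>orbit q b. w i)"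
        using prod.remove[OF finb b_self, of w] by (simp add: mult.assoc)
      finally show ?thesis using finb anb by simp
    qed
    also have "(\<Prod>\<gamma>\<in>orbit q ` I - {orbit q b}. f (\<Prod>i\<in>\<gamma>. w i))
        = (\<Prod>\<gamma>\<in>orbit q ` I - {orbit q b}. f (\<Prod>i\<in>\<gamma>. ?w i))"
    proof (rule prod.cong[OF refl])
      fix \<gamma> assume "\<gamma> \<in> orbit q ` I - {orbit q b}"
      then have "b \<notin> \<gamma>"
        using orbit_cyclic_eq3[OF cyclic_on_orbit'[OF perm]] by blast
      then show "f (\<Prod>i\<in>\<gamma>. w i) = f (\<Prod>i\<in>\<gamma>. ?w i)"
        by (intro arg_cong[where f = f] prod.cong) auto
    qed
    also have "f (\<Prod>i\<in>orbit q b. ?w i) * \<dots> = (\<Prod>\<gamma>\<in>orbit q ` I. f (\<Prod>i\<in>\<gamma>. ?w i))"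
      using fin b by (subst prod.remove[of "orbit q ` I" "orbit q b"]) auto
    finally have "(\<Prod>\<gamma>\<in>orbit ?p ` insert a I. f (\<Prod>i\<in>\<gamma>. w i))
        = (\<Prod>\<gamma>\<in>orbit q ` I. f (\<Prod>i\<in>\<gamma>. ?w i))" .
    then show ?thesis
      unfolding sgn by (simp only: of_int_minus complex_vector.scale_minus_left)
  qed
  have "Phi_family f (insert a I) w
      = (\<Sum>b\<in>insert a I. \<Sum>q | q permutes I. ?F (transpose a b \<circ> q) (insert a I) w)"
    unfolding Phi_family_def by (rule sum_over_permutations_insert[OF fin a])
  also have "\<dots> = (\<Sum>q | q permutes I. ?F (transpose a a \<circ> q) (insert a I) w)
      + (\<Sum>b\<in>I. \<Sum>q | q permutes I. ?F (transpose a b \<circ> q) (insert a I) w)"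
    using fin a by (rule sum.insert)
  also have "(\<Sum>q | q permutes I. ?F (transpose a a \<circ> q) (insert a I) w)
      = f (w a) * Phi_family f I w"
    unfolding Phi_family_def sum_distrib_left by (rule sum.cong[OF refl]) (use fixed in simp)
  also have "(\<Sum>b\<in>I. \<Sum>q | q permutes I. ?F (transpose a b \<circ> q) (insert a I) w)
      = (\<Sum>b\<in>I. - Phi_family f I (w(b := w a * w b)))"
    unfolding Phi_family_def sum_negf[symmetric]
    by (intro sum.cong[OF refl]) (use moved in simp)
  finally show ?thesis by (simp add: sum_negf)
qed

section \<open>Dependence on the family and on the index set\<close>

lemma Phi_family_cong:
  assumes "finite I" "\<And>i. i \<in> I \<Longrightarrow> v i = w i"
  shows "Phi_family f I v = Phi_family f I w"
  using assms
proof (induction I arbitrary: v w rule: finite_induct)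
  case empty
  show ?case by (simp add: Phi_family_empty)
next
  case (insert a I)
  have "Phi_family f I v = Phi_family f I w"
    by (rule insert.IH) (simp add: insert.prems)
  moreover have "Phi_family f I (v(b := v a * v b)) = Phi_family f I (w(b := w a * w b))"
    if "b \<in> I" for b
    by (rule insert.IH) (use that insert.prems in auto)
  ultimately show ?case
    using insert.hyps insert.prems by (simp add: Phi_family_insert)
qed

text \<open>Induction along the recursion avoids transporting permutations, signs and orbits along
  \<open>p\<close>.\<close>

lemma Phi_family_reindex:
  assumes "finite I" "inj_on p I"
  shows "Phi_family f (p ` I) w = Phi_family f I (w \<circ> p)"
  using assms
proof (induction I arbitrary: w rule: finite_induct)
  case empty
  show ?case by (simp add: Phi_family_empty)
next
  case (insert a I)
  have inj: "inj_on p I" and pa: "p a \<notin> p ` I"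
    using insert.prems insert.hyps by auto
  have "Phi_family f (p ` I) (w(p b := w (p a) * w (p b)))
      = Phi_family f I ((w \<circ> p)(b := w (p a) * w (p b)))" if b: "b \<in> I" for b
    unfolding insert.IH[OF inj]
    by (rule Phi_family_cong[OF insert.hyps(1)]) (use b inj in \<open>auto simp: inj_on_def\<close>)
  then show ?case
    using insert.hyps pa
    by (simp add: Phi_family_insert insert.IH[OF inj] sum.reindex[OF inj] o_def)
qed

lemma Phi_family_permute:
  assumes "finite I" "\<sigma> permutes I"
  shows "Phi_family f I (w \<circ> \<sigma>) = Phi_family f I w"
  using Phi_family_reindex[OF assms(1) permutes_inj_on[OF assms(2)], of f w]
  by (simp add: permutes_image[OF assms(2)])

text \<open>An argument \<open>1\<close> changes no entry it is multiplied into, so by the recursion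
  adding it to \<open>m\<close> other arguments multiplies the value by \<open>f 1 - m\<close>, that
  is by \<open>n - m\<close>.\<close>

lemma Phi_family_ones:
  fixes f :: "'a::complex_comm_algebra \<Rightarrow> 'b::complex_comm_algebra"
  assumes f1: "f 1 = of_nat n *\<^sub>C 1" and "finite J" "finite I" "I \<inter> J = {}"
    and "\<And>j. j \<in> J \<Longrightarrow> w j = 1"
  shows "Phi_family f (J \<union> I) w
    = (\<Prod>k<card J. of_nat n - of_nat (card I + k)) *\<^sub>C Phi_family f I w"
  using assms(2-)
proof (induction J rule: finite_induct)
  case empty
  show ?case by (simp add: scaleC_one)
next
  case (insert a J)
  let ?K = "J \<union> I"
  have "w(b := w a * w b) = w" for b
    using insert.prems(3) by auto
  then have "Phi_family f (insert a ?K) w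
      = f (w a) * Phi_family f ?K w - (\<Sum>b\<in>?K. Phi_family f ?K w)"
    using insert.hyps insert.prems by (subst Phi_family_insert) auto
  also have "(\<Sum>b\<in>?K. Phi_family f ?K w) = of_nat (card ?K) *\<^sub>C Phi_family f ?K w"
    by (rule complex_vector.sum_constant_scale)
  also have "card ?K = card I + card J"
    using insert.hyps insert.prems by (subst card_Un_disjoint) auto
  also have "f (w a) * Phi_family f ?K w - of_nat (card I + card J) *\<^sub>C Phi_family f ?K w
      = (of_nat n - of_nat (card I + card J)) *\<^sub>C Phi_family f ?K w"
    using insert.prems(3)[of a] f1
    by (simp add: scaleC_mult_left complex_vector.scale_left_diff_distrib)
  also have "Phi_family f ?K w
      = (\<Prod>k<card J. of_nat n - of_nat (card I + k)) *\<^sub>C Phi_family f I w"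
    using insert.prems by (intro insert.IH) auto
  finally show ?case
    using insert.hyps by (simp add: scaleC_scaleC mult.commute)
qed

text \<open>With \<open>n\<close> slots in all, the factors in \<open>Phi_family_ones\<close> run
  from \<open>n - card I\<close> down to \<open>1\<close>.\<close>

lemma Phi_family_fill_ones:
  fixes f :: "'a::complex_comm_algebra \<Rightarrow> 'b::complex_comm_algebra"
  assumes f1: "f 1 = of_nat n *\<^sub>C 1" and "finite K" "I \<subseteq> K" "card K = n"
    and "\<And>j. j \<in> K - I \<Longrightarrow> w j = 1"
  shows "Phi_family f K w = fact (n - card I) *\<^sub>C Phi_family f I w"
proof -
  let ?J = "K - I"
  have fin: "finite I" using assms finite_subset by blast
  have card: "card ?J = n - card I" and le: "card I \<le> n"
    using assms fin card_mono by (auto simp: card_Diff_subset)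
  have "?J \<union> I = K" using assms(3) by blast
  moreover have "(\<Prod>k<card ?J. of_nat n - of_nat (card I + k)) = (fact (n - card I) :: complex)"
  proof -
    have "fact (n - card I) = (\<Prod>k<n - card I. of_nat (n - card I) - of_nat k :: complex)"
      by (simp add: fact_prod_rev of_nat_prod atLeast0LessThan of_nat_diff diff_diff_eq)
    also have "\<dots> = (\<Prod>k<card ?J. of_nat n - of_nat (card I + k))"
      unfolding card using le by (intro prod.cong) (auto simp: of_nat_diff diff_diff_eq)
    finally show ?thesis by simp
  qed
  ultimately show ?thesis
    using Phi_family_ones[of f n ?J I w, OF f1] assms fin by auto
qed


section \<open>Products of values of Phi\<close>

text \<open>Injections of \<open>I\<close> into \<open>N\<close>, continued by the identity outside \<open>I\<close>, so that the
  injections of a finite \<open>N\<close> into itself are the permutations of \<open>N\<close>.\<close>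
definition injections :: "'i set \<Rightarrow> 'i set \<Rightarrow> ('i \<Rightarrow> 'i) set" where
  "injections I N = {\<iota>. \<iota> ` I \<subseteq> N \<and> inj_on \<iota> I \<and> (\<forall>x. x \<notin> I \<longrightarrow> \<iota> x = x)}"

lemma finite_injections:
  assumes "finite I" "finite N" shows "finite (injections I N)"
proof (rule finite_subset)
  show "injections I N \<subseteq> (\<lambda>g x. if x \<in> I then g x else x) ` (I \<rightarrow>\<^sub>E N)"
  proof
    fix \<iota> assume \<iota>: "\<iota> \<in> injections I N"
    then have "restrict \<iota> I \<in> I \<rightarrow>\<^sub>E N"
      by (auto simp: injections_def)
    moreover have "\<iota> = (\<lambda>x. if x \<in> I then restrict \<iota> I x else x)"
      using \<iota> by (auto simp: injections_def)
    ultimately show "\<iota> \<in> (\<lambda>g x. if x \<in> I then g x else x) ` (I \<rightarrow>\<^sub>E N)"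
      by blast
  qed
qed (use assms in \<open>auto intro: finite_PiE\<close>)

lemma injections_empty: "injections {} N = {id}"
  by (auto simp: injections_def)

lemma injections_self:
  assumes "finite N" shows "injections N N = {p. p permutes N}"
proof (intro equalityI subsetI)
  fix p assume p: "p \<in> injections N N"
  then have "p ` N = N"
    using endo_inj_surj[OF assms] by (auto simp: injections_def)
  then show "p \<in> {p. p permutes N}"
    using p by (auto simp: injections_def bij_betw_def intro!: bij_imp_permutes)
next
  fix p assume "p \<in> {p. p permutes N}"
  then show "p \<in> injections N N"
    by (auto simp: injections_def permutes_not_in permutes_inj_on permutes_in_image)
qed

lemma sum_injections_insert:
  assumes "finite I" "finite N" "a \<notin> I"
  shows "(\<Sum>\<iota>\<in>injections (insert a I) N. F \<iota>)
    = (\<Sum>\<iota>\<in>injections I N. \<Sum>k\<in>N - \<iota> ` I. F (\<iota>(a := k)))"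
proof -
  have "(\<Sum>\<iota>\<in>injections I N. \<Sum>k\<in>N - \<iota> ` I. F (\<iota>(a := k)))
      = (\<Sum>(\<iota>, k)\<in>(SIGMA \<iota>:injections I N. N - \<iota> ` I). F (\<iota>(a := k)))"
    using assms by (subst sum.Sigma) (auto simp: finite_injections)
  also have "\<dots> = (\<Sum>\<iota>\<in>injections (insert a I) N. F \<iota>)"
  \<comment> \<open>Resetting the value at \<open>a\<close> to the default \<open>a\<close> recovers
    the injection of \<open>I\<close>.\<close>
  proof (rule sum.reindex_bij_witness[of _ "\<lambda>\<iota>. (\<iota>(a := a), \<iota> a)" "\<lambda>(\<iota>, k). \<iota>(a := k)"])
    fix x assume "x \<in> (SIGMA \<iota>:injections I N. N - \<iota> ` I)"
    then obtain \<iota> k where x: "x = (\<iota>, k)" "\<iota> \<in> injections I N" "k \<in> N" "k \<notin> \<iota> ` I"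
      by auto
    then have "\<iota> a = a" using assms(3) by (simp add: injections_def)
    then show "(\<lambda>\<iota>. (\<iota>(a := a), \<iota> a)) (case x of (\<iota>, k) \<Rightarrow> \<iota>(a := k)) = x"
      using x by auto
    have "\<iota>(a := k) ` I = \<iota> ` I" "inj_on (\<iota>(a := k)) I = inj_on \<iota> I"
      using assms(3) by (auto intro!: image_cong inj_on_cong)
    then show "(case x of (\<iota>, k) \<Rightarrow> \<iota>(a := k)) \<in> injections (insert a I) N"
      using x assms(3) by (auto simp: injections_def)
  next
    fix \<iota> assume \<iota>: "\<iota> \<in> injections (insert a I) N"
    have "\<iota>(a := a) ` I = \<iota> ` I" "inj_on (\<iota>(a := a)) I = inj_on \<iota> I"
      using assms(3) by (auto intro!: image_cong inj_on_cong)
    then show "(\<iota>(a := a), \<iota> a) \<in> (SIGMA \<iota>:injections I N. N - \<iota> ` I)"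
      using \<iota> assms(3) by (auto simp: injections_def)
  qed auto
  finally show ?thesis by simp
qed

text \<open>The hypothesis on \<open>H\<close> holds for \<open>H = Phi_family f N\<close> as soon as \<open>Phi_family f\<close> vanishes on
  sets with one element more than \<open>N\<close>.\<close>
lemma Phi_family_times:
  fixes f :: "'a::complex_comm_algebra \<Rightarrow> 'b::complex_comm_algebra" and H :: "('i \<Rightarrow> 'a) \<Rightarrow> 'b"
  assumes H: "\<And>c v. f c * H v = (\<Sum>k\<in>N. H (v(k := c * v k)))"
    and N: "finite N" and "finite I"
  shows "Phi_family f I u * H v
    = (\<Sum>\<iota>\<in>injections I N. H (\<lambda>j. v j * (\<Prod>i | i \<in> I \<and> \<iota> i = j. u i)))"
  using assms(3)
proof (induction I arbitrary: u rule: finite_induct)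
  case empty
  show ?case by (simp add: Phi_family_empty injections_empty)
next
  case (insert a I)
  define X where "X = (\<lambda>\<iota> u j. v j * (\<Prod>i | i \<in> I \<and> \<iota> i = j. u i))"
  have IH: "Phi_family f I u * H v = (\<Sum>\<iota>\<in>injections I N. H (X \<iota> u))" for u
    unfolding X_def by (rule insert.IH)
  \<comment> \<open>Sending the new index \<open>a\<close> to \<open>k\<close> multiplies the entry
    at \<open>k\<close> once more, by \<open>u a\<close>.\<close>
  have new: "(\<lambda>j. v j * (\<Prod>i | i \<in> insert a I \<and> (\<iota>(a := k)) i = j. u i))
      = (X \<iota> u)(k := u a * X \<iota> u k)" for \<iota> k
  proof
    fix j
    have "{i. i \<in> insert a I \<and> (\<iota>(a := k)) i = j}
        = (if j = k then insert a {i \<in> I. \<iota> i = j} else {i \<in> I. \<iota> i = j})"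
      using insert.hyps(2) by auto
    then show "v j * (\<Prod>i | i \<in> insert a I \<and> (\<iota>(a := k)) i = j. u i)
        = ((X \<iota> u)(k := u a * X \<iota> u k)) j"
      using insert.hyps by (auto simp: X_def mult.left_commute)
  qed
  \<comment> \<open>By injectivity \<open>b\<close> is the only index sent to
    \<open>\<iota> b\<close>, so enlarging \<open>u b\<close> affects that single entry.\<close>
  have old: "X \<iota> (u(b := u a * u b)) = (X \<iota> u)(\<iota> b := u a * X \<iota> u (\<iota> b))"
    if \<iota>: "\<iota> \<in> injections I N" and b: "b \<in> I" for \<iota> b
  proof
    fix j
    show "X \<iota> (u(b := u a * u b)) j = ((X \<iota> u)(\<iota> b := u a * X \<iota> u (\<iota> b))) j"
    proof (cases "j = \<iota> b")
      case True
      have "{i. i \<in> I \<and> \<iota> i = \<iota> b} = {b}"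
        using \<iota> b by (auto simp: injections_def inj_on_def)
      then show ?thesis using True by (simp add: X_def mult.left_commute)
    next
      case False
      then have "(\<Prod>i | i \<in> I \<and> \<iota> i = j. (u(b := u a * u b)) i) = (\<Prod>i | i \<in> I \<and> \<iota> i = j. u i)"
        by (intro prod.cong) auto
      then show ?thesis using False by (simp add: X_def)
    qed
  qed
  have "Phi_family f (insert a I) u * H v = f (u a) * (Phi_family f I u * H v)
      - (\<Sum>b\<in>I. Phi_family f I (u(b := u a * u b)) * H v)"
    using insert.hyps by (simp add: Phi_family_insert left_diff_distrib sum_distrib_right mult.assoc)
  also have "(\<Sum>b\<in>I. Phi_family f I (u(b := u a * u b)) * H v)
      = (\<Sum>\<iota>\<in>injections I N. \<Sum>b\<in>I. H (X \<iota> (u(b := u a * u b))))"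
    unfolding IH by (rule sum.swap)
  also have "\<dots> = (\<Sum>\<iota>\<in>injections I N. \<Sum>k\<in>\<iota> ` I. H ((X \<iota> u)(k := u a * X \<iota> u k)))"
    by (rule sum.cong[OF refl], subst sum.reindex) (auto simp: injections_def old)
  also have "f (u a) * (Phi_family f I u * H v)
      = (\<Sum>\<iota>\<in>injections I N. \<Sum>k\<in>N. H ((X \<iota> u)(k := u a * X \<iota> u k)))"
    unfolding IH sum_distrib_left by (simp add: H)
  \<comment> \<open>\<open>f (u a)\<close> reaches every slot in \<open>N\<close>; the subtracted
    terms of the recursion are those where the slot is already taken. The free slots are the
    possible values at \<open>a\<close> of an extended injection.\<close>
  also have "\<dots> - (\<Sum>\<iota>\<in>injections I N. \<Sum>k\<in>\<iota> ` I. H ((X \<iota> u)(k := u a * X \<iota> u k)))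
      = (\<Sum>\<iota>\<in>injections I N. \<Sum>k\<in>N - \<iota> ` I. H ((X \<iota> u)(k := u a * X \<iota> u k)))"
    unfolding sum_subtractf[symmetric]
    by (intro sum.cong[OF refl] sum_diff[symmetric] N) (auto simp: injections_def)
  also have "\<dots> = (\<Sum>\<iota>\<in>injections (insert a I) N.
      H (\<lambda>j. v j * (\<Prod>i | i \<in> insert a I \<and> \<iota> i = j. u i)))"
    unfolding sum_injections_insert[OF insert.hyps(1) N insert.hyps(2)] new ..
  finally show ?case .
qed

text \<open>For \<open>I = N\<close> the injections are permutations, each slot receives exactly one
  factor, and inverting all permutations leaves the sum unchanged.\<close>

lemma Phi_family_times_self:
  fixes f :: "'a::complex_comm_algebra \<Rightarrow> 'b::complex_comm_algebra"
  assumes N: "finite N"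
    and f: "\<And>c v. f c * Phi_family f N v = (\<Sum>k\<in>N. Phi_family f N (v(k := c * v k)))"
  shows "Phi_family f N u * Phi_family f N v
    = (\<Sum>\<sigma> | \<sigma> permutes N. Phi_family f N (\<lambda>j. u (\<sigma> j) * v j))"
proof -
  have "Phi_family f N u * Phi_family f N v = (\<Sum>\<sigma> | \<sigma> permutes N.
      Phi_family f N (\<lambda>j. v j * (\<Prod>i | i \<in> N \<and> \<sigma> i = j. u i)))"
    using Phi_family_times[of f "Phi_family f N", OF f N N] by (simp add: injections_self N)
  also have "\<dots> = (\<Sum>\<sigma> | \<sigma> permutes N. Phi_family f N (\<lambda>j. u (inv \<sigma> j) * v j))"
  proof (intro sum.cong[OF refl] Phi_family_cong[OF N])
    fix \<sigma> j assume \<sigma>: "\<sigma> \<in> {\<sigma>. \<sigma> permutes N}" and "j \<in> N"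
    then have "{i. i \<in> N \<and> \<sigma> i = j} = {inv \<sigma> j}"
      using permutes_inverses[of \<sigma> N] permutes_in_image[OF permutes_inv, of \<sigma> N] by auto
    then show "v j * (\<Prod>i | i \<in> N \<and> \<sigma> i = j. u i) = u (inv \<sigma> j) * v j"
      by (simp add: mult.commute)
  qed
  also have "\<dots> = (\<Sum>\<sigma> | \<sigma> permutes N. Phi_family f N (\<lambda>j. u (\<sigma> j) * v j))"
    by (rule sum_permutations_inverse[symmetric])
  finally show ?thesis .
qed


section \<open>Elementary and symmetrized tensors\<close>

text \<open>Families instead of lists match \<open>Phi_family\<close> and turn permuting the factors
  into composition; only the entries below \<open>n\<close> count.\<close>

abbreviation pure_tensor :: "nat \<Rightarrow> (nat \<Rightarrow> 'a::complex_comm_algebra) \<Rightarrow> 'a tensor" where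
  "pure_tensor n w \<equiv> tensor_of (map w [0..<n])"

lemma pure_tensor_in_tensor_power: "pure_tensor n w \<in> tensor_power n"
  unfolding tensor_power_def by (intro complex_vector.span_base) auto

lemma tensor_power_pure_eqI:
  assumes "clinear F" "clinear G" "\<And>w. F (pure_tensor n w) = G (pure_tensor n w)"
    and "t \<in> tensor_power n"
  shows "F t = G t"
proof (rule tensor_power_eqI[OF assms(1,2) _ assms(4)])
  fix u :: "'a list" assume "length u = n"
  then show "F (tensor_of u) = G (tensor_of u)"
    using assms(3)[of "(!) u"] by (metis map_nth)
qed

lemma pure_tensor_times: "pure_tensor n v * pure_tensor n w = pure_tensor n (\<lambda>i. v i * w i)"
proof -
  have "map2 (*) (map v [0..<n]) (map w [0..<n]) = map (\<lambda>i. v i * w i) [0..<n]"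
    by (intro nth_equalityI) auto
  then show ?thesis by (simp add: tensor_of_times_tensor_of list_times_def)
qed

lemma permute_pure_tensor:
  assumes "\<sigma> permutes {..<n}"
  shows "permute_tensor n \<sigma> (pure_tensor n w) = pure_tensor n (w \<circ> \<sigma>)"
proof -
  have "permute_list \<sigma> (map w [0..<n]) = map (w \<circ> \<sigma>) [0..<n]"
    using permutes_in_image[OF assms] by (intro nth_equalityI) (auto simp: permute_list_def)
  then show ?thesis by (simp add: permute_tensor_tensor_of[OF assms])
qed

lemma Phi_pure_tensor:
  assumes "clinear f" shows "Phi n f (pure_tensor n w) = Phi_family f {..<n} w"
proof -
  have "Phi n f (pure_tensor n w) = Phi_family f {..<n} ((!) (map w [0..<n]))"
    by (simp add: Phi_tensor_of[OF assms] Phi_list_def Phi_family_def)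
  also have "\<dots> = Phi_family f {..<n} w"
    by (rule Phi_family_cong) auto
  finally show ?thesis .
qed

section \<open>Symmetrization and slot sums\<close>

definition symmetrize :: "nat \<Rightarrow> 'a::complex_comm_algebra tensor \<Rightarrow> 'a tensor" where
  "symmetrize n t = (\<Sum>\<sigma> | \<sigma> permutes {..<n}. permute_tensor n \<sigma> t)"

lemma clinear_symmetrize: "clinear (symmetrize n)"
  by (rule clinearI)
    (simp_all add: symmetrize_def clinear_add[OF clinear_permute_tensor]
      clinear_scale[OF clinear_permute_tensor] sum.distrib complex_vector.scale_sum_right)

lemma symmetrize_symmetric:
  assumes "t \<in> symmetric_tensors n" shows "symmetrize n t = fact n *\<^sub>C t"
proof -
  have "symmetrize n t = (\<Sum>\<sigma> | \<sigma> permutes {..<n}. t)"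
    unfolding symmetrize_def using assms by (intro sum.cong) (auto simp: symmetric_tensors_def)
  also have "\<dots> = fact n *\<^sub>C t"
    by (simp add: complex_vector.sum_constant_scale card_permutations[of _ n])
  finally show ?thesis .
qed

lemma symmetrize_pure_tensor:
  "symmetrize n (pure_tensor n w) = (\<Sum>\<sigma> | \<sigma> permutes {..<n}. pure_tensor n (w \<circ> \<sigma>))"
  unfolding symmetrize_def by (rule sum.cong) (simp_all add: permute_pure_tensor)

lemma tensor_power_sum:
  "(\<And>i. i \<in> I \<Longrightarrow> t i \<in> tensor_power n) \<Longrightarrow> (\<Sum>i\<in>I. t i) \<in> tensor_power n"
  unfolding tensor_power_def by (rule complex_vector.span_sum)

text \<open>Applying \<open>\<tau>\<close> replaces each summation index \<open>\<sigma>\<close> by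
  \<open>\<sigma> \<circ> \<tau>\<close>, which only reorders the sum.\<close>

lemma symmetrize_pure_tensor_symmetric:
  "symmetrize n (pure_tensor n w) \<in> symmetric_tensors n"
proof -
  have "permute_tensor n \<tau> (symmetrize n (pure_tensor n w)) = symmetrize n (pure_tensor n w)"
    if \<tau>: "\<tau> permutes {..<n}" for \<tau>
  proof -
    have "permute_tensor n \<tau> (symmetrize n (pure_tensor n w))
        = (\<Sum>\<sigma> | \<sigma> permutes {..<n}. pure_tensor n (w \<circ> (\<sigma> \<circ> \<tau>)))"
      by (simp add: symmetrize_pure_tensor clinear_sum[OF clinear_permute_tensor[OF \<tau>]]
          permute_pure_tensor[OF \<tau>] o_assoc)
    also have "\<dots> = symmetrize n (pure_tensor n w)"
      unfolding symmetrize_pure_tensor by (rule sum_permutations_compose_right[OF \<tau>, symmetric])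
    finally show ?thesis .
  qed
  then show ?thesis
    by (simp add: symmetric_tensors_def symmetrize_pure_tensor tensor_power_sum
        pure_tensor_in_tensor_power)
qed

text \<open>Multiplication by this tensor multiplies the slots by \<open>a\<close> one at a time,
  mirroring the right hand side of \<open>frobenius_hom_derivation\<close>.\<close>

definition slot_sum :: "nat \<Rightarrow> 'a::complex_comm_algebra \<Rightarrow> 'a tensor" where
  "slot_sum n a = (\<Sum>j<n. pure_tensor n ((\<lambda>_. 1)(j := a)))"

lemma slot_sum_symmetric: "slot_sum n a \<in> symmetric_tensors n"
proof -
  have "permute_tensor n \<tau> (slot_sum n a) = slot_sum n a" if \<tau>: "\<tau> permutes {..<n}" for \<tau>
  proof -
    have "((\<lambda>_. 1)(j := a)) \<circ> \<tau> = (\<lambda>_. 1)(inv \<tau> j := a)" for j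
      using permutes_inverses[OF \<tau>] by (auto simp: fun_eq_iff)
    then have "permute_tensor n \<tau> (slot_sum n a) = (\<Sum>j<n. pure_tensor n ((\<lambda>_. 1)(inv \<tau> j := a)))"
      by (simp only: slot_sum_def clinear_sum[OF clinear_permute_tensor[OF \<tau>]]
          permute_pure_tensor[OF \<tau>])
    also have "\<dots> = slot_sum n a"
      unfolding slot_sum_def
      by (rule sum.reindex_bij_betw[OF permutes_imp_bij[OF permutes_inv[OF \<tau>]]])
    finally show ?thesis .
  qed
  then show ?thesis
    by (simp add: symmetric_tensors_def slot_sum_def tensor_power_sum pure_tensor_in_tensor_power)
qed

lemma slot_sum_times_pure_tensor:
  "slot_sum n a * pure_tensor n w = (\<Sum>j<n. pure_tensor n (w(j := a * w j)))"
proof -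
  have "(\<lambda>i. ((\<lambda>_. 1)(j := a)) i * w i) = w(j := a * w j)" for j
    by auto
  then show ?thesis
    by (simp only: slot_sum_def sum_distrib_right pure_tensor_times)
qed


section \<open>Frobenius homomorphisms\<close>

text \<open>With \<open>c\<close> placed in an extra slot \<open>n\<close>, the recursion for that
  slot expands the vanishing value into the difference of the two sides.\<close>

lemma frobenius_hom_derivation:
  assumes "frobenius_hom n f"
  shows "f c * Phi_family f {..<n} v = (\<Sum>k<n. Phi_family f {..<n} (v(k := c * v k)))"
proof -
  let ?w = "v(n := c)"
  have "clinear f" "Phi (Suc n) f (pure_tensor (Suc n) ?w) = 0"
    using assms pure_tensor_in_tensor_power by (auto simp: frobenius_hom_def simp del: upt_Suc)
  then have "Phi_family f (insert n {..<n}) ?w = 0"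
    by (simp only: Phi_pure_tensor flip: lessThan_Suc)
  then have "f c * Phi_family f {..<n} ?w = (\<Sum>k<n. Phi_family f {..<n} (?w(k := c * ?w k)))"
    by (simp add: Phi_family_insert)
  also have "\<dots> = (\<Sum>k<n. Phi_family f {..<n} (v(k := c * v k)))"
    by (intro sum.cong[OF refl] Phi_family_cong) auto
  also have "Phi_family f {..<n} ?w = Phi_family f {..<n} v"
    by (rule Phi_family_cong) auto
  finally show ?thesis .
qed

text \<open>Both sides are bilinear, so elementary tensors suffice, and there
  \<open>Phi_family_times_self\<close> applies: symmetrizing one factor supplies its sum over
  permutations.\<close>

lemma frobenius_hom_Phi_times:
  assumes f: "frobenius_hom n f" and s: "s \<in> tensor_power n" and t: "t \<in> tensor_power n"
  shows "Phi n f (symmetrize n s * t) = Phi n f s * Phi n f t"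
proof -
  have lin: "clinear f" using f by (simp add: frobenius_hom_def)
  note simps = clinear_add[OF clinear_Phi[OF lin]] clinear_scale[OF clinear_Phi[OF lin]]
    clinear_add[OF clinear_symmetrize] clinear_scale[OF clinear_symmetrize]
    clinear_scale[OF clinear_times_tensor_left] clinear_scale[OF clinear_times_tensor_right]
    scaleC_mult_left scaleC_mult_right distrib_left distrib_right
  have pure: "Phi n f (symmetrize n (pure_tensor n u) * pure_tensor n v)
      = Phi n f (pure_tensor n u) * Phi n f (pure_tensor n v)" for u v
    by (simp add: symmetrize_pure_tensor sum_distrib_right pure_tensor_times
        clinear_sum[OF clinear_Phi[OF lin]] Phi_pure_tensor[OF lin]
        Phi_family_times_self[OF _ frobenius_hom_derivation[OF f]])
  have *: "Phi n f (symmetrize n (pure_tensor n u) * t) = Phi n f (pure_tensor n u) * Phi n f t" for u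
    by (rule tensor_power_pure_eqI[of "\<lambda>t. Phi n f (symmetrize n (pure_tensor n u) * t)"
          "\<lambda>t. Phi n f (pure_tensor n u) * Phi n f t", OF _ _ _ t])
      (auto intro!: clinearI simp: simps pure)
  show ?thesis
    by (rule tensor_power_pure_eqI[of "\<lambda>s. Phi n f (symmetrize n s * t)"
          "\<lambda>s. Phi n f s * Phi n f t", OF _ _ _ s])
      (auto intro!: clinearI simp: simps *)
qed

section \<open>Values at the unit and at the slot sums\<close>

lemma Phi_tensor_one:
  fixes f :: "'a::complex_comm_algebra \<Rightarrow> 'b::complex_comm_algebra"
  assumes "clinear f" "f 1 = of_nat n *\<^sub>C 1"
  shows "Phi n f (tensor_one n) = fact n *\<^sub>C 1"
proof -
  have "(tensor_one n :: 'a tensor) = pure_tensor n (\<lambda>_. 1)"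
    by (simp add: tensor_one_def map_replicate_const)
  then have "Phi n f (tensor_one n) = Phi_family f {..<n} (\<lambda>_. 1)"
    by (simp only: Phi_pure_tensor[OF assms(1)])
  then show ?thesis
    using Phi_family_fill_ones[of f n "{..<n}" "{}" "\<lambda>_. 1", OF assms(2)]
    by (simp add: Phi_family_empty)
qed

text \<open>Each of the \<open>n\<close> summands has \<open>n - 1\<close> entries \<open>1\<close>
  and gives \<open>fact (n - 1)\<close> times \<open>f a\<close>. For \<open>n = 0\<close> the sum
  would be empty but the right hand side \<open>f a\<close>; this is where \<open>n \<ge> 1\<close>
  enters.\<close>

lemma Phi_slot_sum:
  assumes "clinear f" "f 1 = of_nat n *\<^sub>C 1" "n \<ge> 1"
  shows "Phi n f (slot_sum n a) = fact n *\<^sub>C f a"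
proof -
  have "Phi_family f {j} w = f (w j)" for j :: nat and w
    using Phi_family_insert[of "{}" j f w] by (simp add: Phi_family_empty)
  then have "Phi_family f {..<n} ((\<lambda>_. 1)(j := a)) = fact (n - 1) *\<^sub>C f a" if "j < n" for j
    using that Phi_family_fill_ones[of f n "{..<n}" "{j}" "(\<lambda>_. 1)(j := a)", OF assms(2)] by simp
  then have "Phi n f (slot_sum n a) = of_nat n *\<^sub>C fact (n - 1) *\<^sub>C f a"
    by (simp add: slot_sum_def clinear_sum[OF clinear_Phi[OF assms(1)]] Phi_pure_tensor[OF assms(1)]
        complex_vector.sum_constant_scale del: fun_upd_apply)
  also have "\<dots> = fact n *\<^sub>C f a"
    using assms(3) by (simp add: scaleC_scaleC fact_reduce)
  finally show ?thesis .
qed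

section \<open>The two implications\<close>

lemma frobenius_hom_imp_ring_hom_on:
  assumes f: "frobenius_hom n f"
  shows "ring_hom_on (symmetric_tensors n) (tensor_one n) (\<lambda>t. (1 / fact n) *\<^sub>C Phi n f t)"
  unfolding ring_hom_on_def
proof (intro conjI ballI)
  have lin: "clinear f" and f1: "f 1 = of_nat n *\<^sub>C 1"
    using f by (simp_all add: frobenius_hom_def)
  show "(1 / fact n) *\<^sub>C Phi n f (tensor_one n) = 1"
    by (simp add: Phi_tensor_one[OF lin f1] scaleC_scaleC scaleC_one)
  fix s t :: "'a tensor" assume st: "s \<in> symmetric_tensors n" "t \<in> symmetric_tensors n"
  show "(1 / fact n) *\<^sub>C Phi n f (s + t) = (1 / fact n) *\<^sub>C Phi n f s + (1 / fact n) *\<^sub>C Phi n f t"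
    by (simp add: clinear_add[OF clinear_Phi[OF lin]] scaleC_add_right)
  \<comment> \<open>Since \<open>s\<close> is symmetric, symmetrizing it only produces the factor
    \<open>fact n\<close>, which cancels one of the two normalizing factors of the product.\<close>
  have "fact n *\<^sub>C Phi n f (s * t) = Phi n f (symmetrize n s * t)"
    by (simp add: symmetrize_symmetric[OF st(1)] clinear_scale[OF clinear_times_tensor_left]
        clinear_scale[OF clinear_Phi[OF lin]])
  also have "\<dots> = Phi n f s * Phi n f t"
    using st by (intro frobenius_hom_Phi_times[OF f]) (auto simp: symmetric_tensors_def)
  finally have "(1 / fact n * (1 / fact n)) *\<^sub>C fact n *\<^sub>C Phi n f (s * t)
      = (1 / fact n) *\<^sub>C Phi n f s * (1 / fact n) *\<^sub>C Phi n f t"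
    by (simp add: scaleC_mult_left scaleC_mult_right scaleC_scaleC)
  then show "(1 / fact n) *\<^sub>C Phi n f (s * t)
      = (1 / fact n) *\<^sub>C Phi n f s * (1 / fact n) *\<^sub>C Phi n f t"
    by (simp add: scaleC_scaleC)
qed

lemma ring_hom_on_imp_frobenius_hom:
  assumes n: "n \<ge> 1" and lin: "clinear f" and f1: "f 1 = of_nat n *\<^sub>C 1"
    and hom: "ring_hom_on (symmetric_tensors n) (tensor_one n) (\<lambda>t. (1 / fact n) *\<^sub>C Phi n f t)"
  shows "frobenius_hom n f"
proof -
  let ?h = "\<lambda>t. (1 / fact n) *\<^sub>C Phi n f t"
  have fact: "(\<Sum>\<sigma> | \<sigma> permutes {..<n}. x) = fact n *\<^sub>C x" for x :: 'b
    by (simp add: complex_vector.sum_constant_scale card_permutations[of _ n])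
  have vanish: "Phi_family f {..<Suc n} w = 0" for w
  proof -
    \<comment> \<open>The last of the \<open>n + 1\<close> arguments becomes the multiplier; the
      others form the tensor to be symmetrized.\<close>
    let ?P = "Phi_family f {..<n}" and ?a = "w n" and ?t = "symmetrize n (pure_tensor n w)"
    have "?h (slot_sum n ?a * ?t) = ?h (slot_sum n ?a) * ?h ?t"
      using hom slot_sum_symmetric symmetrize_pure_tensor_symmetric
      unfolding ring_hom_on_def by blast
    moreover have "?h (slot_sum n ?a) = f ?a"
      by (simp add: Phi_slot_sum[OF lin f1 n] scaleC_scaleC scaleC_one)
    moreover have "?h ?t = ?P w"
    proof -
      have "Phi n f ?t = (\<Sum>\<sigma> | \<sigma> permutes {..<n}. ?P w)"
        unfolding symmetrize_pure_tensor clinear_sum[OF clinear_Phi[OF lin]] Phi_pure_tensor[OF lin]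
        by (intro sum.cong[OF refl]) (simp add: Phi_family_permute)
      then show ?thesis by (simp add: fact scaleC_scaleC scaleC_one)
    qed
    moreover have "?h (slot_sum n ?a * ?t) = (\<Sum>k<n. ?P (w(k := ?a * w k)))"
    proof -
      have "Phi n f (slot_sum n ?a * ?t)
          = (\<Sum>\<sigma> | \<sigma> permutes {..<n}. \<Sum>j<n. ?P ((w \<circ> \<sigma>)(j := ?a * w (\<sigma> j))))"
        by (simp only: symmetrize_pure_tensor sum_distrib_left slot_sum_times_pure_tensor
            clinear_sum[OF clinear_Phi[OF lin]] Phi_pure_tensor[OF lin] o_apply)
      also have "\<dots> = (\<Sum>\<sigma> | \<sigma> permutes {..<n}. \<Sum>k<n. ?P (w(k := ?a * w k)))"
      proof (rule sum.cong[OF refl])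
        fix \<sigma> assume "\<sigma> \<in> {\<sigma>. \<sigma> permutes {..<n}}"
        then have \<sigma>: "\<sigma> permutes {..<n}" by simp
        \<comment> \<open>Changing slot \<open>j\<close> after composing with
          \<open>\<sigma>\<close> is changing slot \<open>\<sigma> j\<close> before;
          \<open>?P\<close> ignores the composition, and \<open>\<sigma>\<close> merely renumbers
          the slots. So all permutations contribute equally and \<open>fact n\<close>
          cancels.\<close>
        have "(w \<circ> \<sigma>)(j := ?a * w (\<sigma> j)) = w(\<sigma> j := ?a * w (\<sigma> j)) \<circ> \<sigma>" for j
          using permutes_inj[OF \<sigma>] by (auto simp: fun_eq_iff inj_def)
        then have "(\<Sum>j<n. ?P ((w \<circ> \<sigma>)(j := ?a * w (\<sigma> j))))
            = (\<Sum>j<n. ?P (w(\<sigma> j := ?a * w (\<sigma> j))))"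
          by (simp only: Phi_family_permute[OF finite_lessThan \<sigma>])
        also have "\<dots> = (\<Sum>k<n. ?P (w(k := ?a * w k)))"
          by (rule sum.reindex_bij_betw[OF permutes_imp_bij[OF \<sigma>]])
        finally show "(\<Sum>j<n. ?P ((w \<circ> \<sigma>)(j := ?a * w (\<sigma> j)))) = (\<Sum>k<n. ?P (w(k := ?a * w k)))" .
      qed
      finally show ?thesis by (simp only: fact) (simp add: scaleC_scaleC scaleC_one)
    qed
    \<comment> \<open>The two evaluations agree, and their difference is the recursion at index
      \<open>n\<close> for all \<open>n + 1\<close> arguments.\<close>
    ultimately show ?thesis
      by (simp add: lessThan_Suc Phi_family_insert)
  qed
  have "Phi (Suc n) f t = 0" if "t \<in> tensor_power (Suc n)" for t
    by (rule tensor_power_pure_eqI[OF clinear_Phi[OF lin] _ _ that, of "\<lambda>_. 0"])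
      (auto intro!: clinearI simp: Phi_pure_tensor[OF lin] vanish simp del: upt_Suc)
  then show ?thesis using lin f1 by (simp add: frobenius_hom_def)
qed

theorem theorem1p9:
  fixes f :: "'a::complex_comm_algebra \<Rightarrow> 'b::complex_comm_algebra" and n :: nat
  assumes "n \<ge> 1"
  shows "(frobenius_hom n f \<longrightarrow>
            ring_hom_on (symmetric_tensors n) (tensor_one n) (\<lambda>t. (1 / fact n) *\<^sub>C Phi n f t)) \<and>
         (clinear f \<and> f 1 = of_nat n *\<^sub>C 1 \<and>
            ring_hom_on (symmetric_tensors n) (tensor_one n) (\<lambda>t. (1 / fact n) *\<^sub>C Phi n f t)
          \<longrightarrow> frobenius_hom n f)"
  using assms frobenius_hom_imp_ring_hom_on ring_hom_on_imp_frobenius_hom by blast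

end
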